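(* Let $\mathcal{C}$ be a set of propositional connectives. Then $\mathrm{FOILS}(\mathcal{C}) = \mathrm{FOCDS}(\mathcal{C})$ if and only if every connective $c \in \mathcal{C}$ is supermultiplicative.
   Context: For $\mathbf{a} \in \{0,1\}^n$, $\mathbf{a}[i]$ denotes its $i$-th component, and $\mathbf{a} \sqcap \mathbf{b}$ denotes the componentwise minimum of $\mathbf{a},\mathbf{b} \in \{0,1\}^n$. A propositional connective $c$ is a symbol together with an arity $\mathrm{ar}(c) \ge 0$ and a truth function $f_c : \{0,1\}^{\mathrm{ar}(c)} \to \{0,1\}$. The connective $c$ is supermultiplicative if for all $\mathbf{a},\mathbf{b} \in \{0,1\}^{\mathrm{ar}(c)}$, $f_c(\mathbf{a}) = f_c(\mathbf{b}) = 1$ implies $f_c(\mathbf{a} \sqcap \mathbf{b}) = 1$. The first-order language has individual variables and predicate symbols of every arity $n \ge 0$ (0-ary predicate symbols are propositional symbols), and no function or constant symbols. For a set $\mathcal{C}$ of connectives, the set $\mathrm{Fml}(\mathcal{C})$ of formulas is generated by: atomic formulas $p(x_1,\dots,x_n)$ ($p$ an $n$-ary predicate symbol, $x_i$ variables); $c(\alpha_1,\dots,\alpha_{\mathrm{ar}(c)})$ for $c \in \mathcal{C}$ and $\alpha_i \in \mathrm{Fml}(\mathcal{C})$; $\forall x\alpha$ and $\exists x \alpha$. Free variables are as usual, with $\mathrm{FV}(c(\alpha_1,\dots,\alpha_n)) = \bigcup_i \mathrm{FV}(\alpha_i)$. A Kripke model is $\mathcal{K} = \langle W, \preceq, D, I\rangle$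 where $\preceq$ is a preorder on $W$, $D(w)$ is a nonempty set for each $w$ with $D(w) \subseteq D(v)$ whenever $w \preceq v$, and $I(w,p) : D(w)^n \to \{0,1\}$ for each world $w$ and $n$-ary predicate symbol $p$, with $I(w,p)(a_1,\dots,a_n) \le I(v,p)(a_1,\dots,a_n)$ whenever $w \preceq v$ and $a_i \in D(w)$. It is constant domain if $D(w) = D(v)$ for all $w,v$. For an assignment $\rho$ (a map from variables into $D(w)$), the value $\|\alpha\|^\rho_{\mathcal{K},w} \in \{0,1\}$ is: $\|p(x_1,\dots,x_n)\|^\rho_{\mathcal{K},w} = I(w,p)(\rho(x_1),\dots,\rho(x_n))$; $\|c(\alpha_1,\dots,\alpha_n)\|^\rho_{\mathcal{K},w} = 1$ iff $f_c(\|\alpha_1\|^\rho_{\mathcal{K},v},\dots,\|\alpha_n\|^\rho_{\mathcal{K},v}) = 1$ for all $v \succeq w$; $\|\forall x\alpha\|^\rho_{\mathcal{K},w} = 1$ iff $\|\alpha\|^{\rho[x\mapsto a]}_{\mathcal{K},v} = 1$ for all $v \succeq w$ and all $a \in D(v)$; $\|\exists x\alpha\|^\rho_{\mathcal{K},w} = 1$ iff $\|\alpha\|^{\rho[x\mapsto a]}_{\mathcal{K},w} = 1$ for some $a \in D(w)$. A sequent is $\Gamma \Rightarrow \Delta$ with $\Gamma,\Delta$ sets of formulas in $\mathrm{Fml}(\mathcal{C})$. Its value at $w$ under $\rho$ is $0$ if all formulas of $\Gamma$ have value $1$ and all formulas of $\Delta$ have value $0$, and $1$ otherwise. It is valid in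 $\mathcal{K}$ if its value is $1$ at every world $w$ under every assignment in $D(w)$. $\mathrm{FOILS}(\mathcal{C})$ is the set of sequents over $\mathrm{Fml}(\mathcal{C})$ valid in all Kripke models; $\mathrm{FOCDS}(\mathcal{C})$ is the set of those valid in all constant domain Kripke models. *)

theory Defs
  imports Main
begin

text \<open>
  The truth values 0 and 1 are the Booleans False and True, ordered by False < True, and
  an element of \<open>{0,1}\<^sup>n\<close> is a Boolean list of length \<open>n\<close>.  Only the values of \<open>truth_fun c\<close> on
  lists of length \<open>arity c\<close> are ever relevant.
\<close>

datatype 's connective =
  Connective (symb: 's) (arity: nat) (truth_fun: "bool list \<Rightarrow> bool")

definition meet :: "bool list \<Rightarrow> bool list \<Rightarrow> bool list" where
  "meet as bs = map2 min as bs"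

definition supermultiplicative :: "'s connective \<Rightarrow> bool" where
  "supermultiplicative c \<longleftrightarrow>
     (\<forall>as bs. length as = arity c \<longrightarrow> length bs = arity c \<longrightarrow>
        truth_fun c as \<longrightarrow> truth_fun c bs \<longrightarrow> truth_fun c (meet as bs))"

text \<open>
  For every arity \<open>n\<close> there is one \<open>n\<close>-ary predicate symbol for each element of the arbitrary
  (nonempty) index type \<open>'p\<close>.  Individual variables are the natural numbers.
\<close>

datatype 'p pred_symb = Pred (pred_index: 'p) (pred_arity: nat)

type_synonym var = nat

datatype ('s, 'p) fml =
    Atom "'p pred_symb" "var list"
  | Conn "'s connective" "('s, 'p) fml list"
  | All var "('s, 'p) fml"
  | Ex var "('s, 'p) fml"

text \<open>The datatype does not enforce arities; the formulas over \<open>C\<close> are the following ones.\<close>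

inductive_set Fml :: "'s connective set \<Rightarrow> ('s, 'p) fml set" for C where
  Atom: "length xs = pred_arity p \<Longrightarrow> Atom p xs \<in> Fml C"
| Conn: "c \<in> C \<Longrightarrow> length \<alpha>s = arity c \<Longrightarrow> (\<And>\<alpha>. \<alpha> \<in> set \<alpha>s \<Longrightarrow> \<alpha> \<in> Fml C) \<Longrightarrow> Conn c \<alpha>s \<in> Fml C"
| All: "\<alpha> \<in> Fml C \<Longrightarrow> All x \<alpha> \<in> Fml C"
| Ex: "\<alpha> \<in> Fml C \<Longrightarrow> Ex x \<alpha> \<in> Fml C"

fun FV :: "('s, 'p) fml \<Rightarrow> var set" where
  "FV (Atom p xs) = set xs"
| "FV (Conn c \<alpha>s) = (\<Union>\<alpha>\<in>set \<alpha>s. FV \<alpha>)"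
| "FV (All x \<alpha>) = FV \<alpha> - {x}"
| "FV (Ex x \<alpha>) = FV \<alpha> - {x}"

record ('w, 'd, 'p) kripke =
  worlds :: "'w set"
  acc :: "'w \<Rightarrow> 'w \<Rightarrow> bool"
  indiv :: "'w \<Rightarrow> 'd set"
  interp :: "'w \<Rightarrow> 'p pred_symb \<Rightarrow> 'd list \<Rightarrow> bool"

definition kripke_model :: "('w, 'd, 'p) kripke \<Rightarrow> bool" where
  "kripke_model K \<longleftrightarrow>
     (\<forall>w\<in>worlds K. acc K w w) \<and>
     (\<forall>u\<in>worlds K. \<forall>v\<in>worlds K. \<forall>w\<in>worlds K. acc K u v \<longrightarrow> acc K v w \<longrightarrow> acc K u w) \<and>
     (\<forall>w\<in>worlds K. indiv K w \<noteq> {}) \<and>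
     (\<forall>w\<in>worlds K. \<forall>v\<in>worlds K. acc K w v \<longrightarrow> indiv K w \<subseteq> indiv K v) \<and>
     (\<forall>w\<in>worlds K. \<forall>v\<in>worlds K. acc K w v \<longrightarrow>
        (\<forall>p as. length as = pred_arity p \<longrightarrow> set as \<subseteq> indiv K w \<longrightarrow>
           interp K w p as \<le> interp K v p as))"

definition constant_domain :: "('w, 'd, 'p) kripke \<Rightarrow> bool" where
  "constant_domain K \<longleftrightarrow> (\<forall>w\<in>worlds K. \<forall>v\<in>worlds K. indiv K w = indiv K v)"

fun val :: "('w, 'd, 'p) kripke \<Rightarrow> 'w \<Rightarrow> (var \<Rightarrow> 'd) \<Rightarrow> ('s, 'p) fml \<Rightarrow> bool" where
  "val K w \<rho> (Atom p xs) \<longleftrightarrow> interp K w p (map \<rho> xs)"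
| "val K w \<rho> (Conn c \<alpha>s) \<longleftrightarrow>
     (\<forall>v\<in>worlds K. acc K w v \<longrightarrow> truth_fun c (map (\<lambda>\<alpha>. val K v \<rho> \<alpha>) \<alpha>s))"
| "val K w \<rho> (All x \<alpha>) \<longleftrightarrow>
     (\<forall>v\<in>worlds K. acc K w v \<longrightarrow> (\<forall>a\<in>indiv K v. val K v (\<rho>(x := a)) \<alpha>))"
| "val K w \<rho> (Ex x \<alpha>) \<longleftrightarrow> (\<exists>a\<in>indiv K w. val K w (\<rho>(x := a)) \<alpha>)"

text \<open>The pair \<open>(\<Gamma>, \<Delta>)\<close> is the sequent with antecedent \<open>\<Gamma>\<close> and succedent \<open>\<Delta>\<close>; both may be infinite.\<close>

type_synonym ('s, 'p) sequent = "('s, 'p) fml set \<times> ('s, 'p) fml set"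

definition sequents :: "'s connective set \<Rightarrow> ('s, 'p) sequent set" where
  "sequents C = {(\<Gamma>, \<Delta>). \<Gamma> \<subseteq> Fml C \<and> \<Delta> \<subseteq> Fml C}"

definition sequent_val ::
    "('w, 'd, 'p) kripke \<Rightarrow> 'w \<Rightarrow> (var \<Rightarrow> 'd) \<Rightarrow> ('s, 'p) sequent \<Rightarrow> bool" where
  "sequent_val K w \<rho> S \<longleftrightarrow>
     \<not> ((\<forall>\<alpha>\<in>fst S. val K w \<rho> \<alpha>) \<and> (\<forall>\<beta>\<in>snd S. \<not> val K w \<rho> \<beta>))"

definition valid :: "('w, 'd, 'p) kripke \<Rightarrow> ('s, 'p) sequent \<Rightarrow> bool" where
  "valid K S \<longleftrightarrow> (\<forall>w\<in>worlds K. \<forall>\<rho>. range \<rho> \<subseteq> indiv K w \<longrightarrow> sequent_val K w \<rho> S)"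

text \<open>
  A HOL formula cannot quantify over all types, so the definitions below let worlds and
  individuals range over one fixed type that is at least as large as the language, namely the
  type of formulas.  This is no restriction: the theorems \<open>FOILS_all_models\<close> and
  \<open>FOCDS_all_models\<close> below show that the sequents in these sets are valid in all (constant
  domain) Kripke models over arbitrary types of worlds and individuals.
\<close>

definition FOILS :: "'s connective set \<Rightarrow> ('s, 'p) sequent set" where
  "FOILS C = {S \<in> sequents C.
     \<forall>K :: (('s, 'p) fml, ('s, 'p) fml, 'p) kripke. kripke_model K \<longrightarrow> valid K S}"

definition FOCDS :: "'s connective set \<Rightarrow> ('s, 'p) sequent set" where
  "FOCDS C = {S \<in> sequents C.
     \<forall>K :: (('s, 'p) fml, ('s, 'p) fml, 'p) kripke.
       kripke_model K \<and> constant_domain K \<longrightarrow> valid K S}"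


subsection \<open>Independence of the choice of types (downward Loewenheim-Skolem)\<close>

lemma finite_FV: "finite (FV \<alpha>)"
  by (induction \<alpha>) auto

lemma val_cong:
  "(\<And>x. x \<in> FV \<alpha> \<Longrightarrow> \<rho> x = \<sigma> x) \<Longrightarrow> val K w \<rho> \<alpha> = val K w \<sigma> \<alpha>"
proof (induction \<alpha> arbitrary: w \<rho> \<sigma>)
  case (Atom p xs)
  then have "map \<rho> xs = map \<sigma> xs" by simp
  then show ?case by (simp only: val.simps)
next
  case (Conn c \<alpha>s)
  have "map (val K v \<rho>) \<alpha>s = map (val K v \<sigma>) \<alpha>s" for v
  proof (rule map_cong[OF refl])
    fix \<alpha> assume a: "\<alpha> \<in> set \<alpha>s"
    show "val K v \<rho> \<alpha> = val K v \<sigma> \<alpha>"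
      by (rule Conn.IH[OF a]) (use a Conn.prems in auto)
  qed
  then show ?case by (simp del: map_eq_conv)
next
  case (All x \<alpha>)
  have "val K v (\<rho>(x := a)) \<alpha> = val K v (\<sigma>(x := a)) \<alpha>" for v a
    by (rule All.IH) (use All.prems in auto)
  then show ?case by simp
next
  case (Ex x \<alpha>)
  have "val K v (\<rho>(x := a)) \<alpha> = val K v (\<sigma>(x := a)) \<alpha>" for v a
    by (rule Ex.IH) (use Ex.prems in auto)
  then show ?case by simp
qed

text \<open>\<open>(v, a)\<close> is a counterexample (for \<open>Ex\<close>: a witness) for \<open>\<alpha>\<close> at \<open>w\<close>, if there is any.\<close>

definition skolem_spec ::
    "('w, 'd, 'p) kripke \<Rightarrow> 'w \<Rightarrow> (var \<Rightarrow> 'd) \<Rightarrow> ('s, 'p) fml \<Rightarrow> 'w \<Rightarrow> 'd \<Rightarrow> bool" where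
  "skolem_spec K w \<rho> \<alpha> v a \<longleftrightarrow>
     v \<in> worlds K \<and> acc K w v \<and> a \<in> indiv K v \<and>
     (case \<alpha> of
        Atom p xs \<Rightarrow> v = w
      | Conn c \<alpha>s \<Rightarrow> val K w \<rho> \<alpha> \<or> \<not> truth_fun c (map (val K v \<rho>) \<alpha>s)
      | All x \<beta> \<Rightarrow> val K w \<rho> \<alpha> \<or> \<not> val K v (\<rho>(x := a)) \<beta>
      | Ex x \<beta> \<Rightarrow> v = w \<and> (val K w \<rho> \<alpha> \<longrightarrow> val K v (\<rho>(x := a)) \<beta>))"

lemma skolem_spec_ex:
  assumes K: "kripke_model K" and w: "w \<in> worlds K"
  shows "\<exists>z. skolem_spec K w \<rho> \<alpha> (fst z) (snd z)"
proof -
  have ne: "v \<in> worlds K \<Longrightarrow> \<exists>a. a \<in> indiv K v" for v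
    using K unfolding kripke_model_def by blast
  have r: "acc K w w" using K w unfolding kripke_model_def by blast
  obtain d where d: "d \<in> indiv K w" using ne[OF w] ..
  have "\<exists>v a. skolem_spec K w \<rho> \<alpha> v a"
  proof (cases \<alpha>)
    case (Atom p xs)
    have "skolem_spec K w \<rho> \<alpha> w d"
      unfolding Atom skolem_spec_def fml.case using w r d by blast
    then show ?thesis by blast
  next
    case (Conn c \<alpha>s)
    show ?thesis
    proof (cases "val K w \<rho> \<alpha>")
      case True
      then have "skolem_spec K w \<rho> \<alpha> w d"
        unfolding Conn skolem_spec_def fml.case using w r d by blast
      then show ?thesis by blast
    next
      case False
      then obtain v where v: "v \<in> worlds K" "acc K w v" "\<not> truth_fun c (map (val K v \<rho>) \<alpha>s)"
        unfolding Conn val.simps by blast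
      obtain a where "a \<in> indiv K v" using ne[OF v(1)] ..
      with v have "skolem_spec K w \<rho> \<alpha> v a"
        unfolding Conn skolem_spec_def fml.case by blast
      then show ?thesis by blast
    qed
  next
    case (All x \<beta>)
    show ?thesis
    proof (cases "val K w \<rho> \<alpha>")
      case True
      then have "skolem_spec K w \<rho> \<alpha> w d"
        unfolding All skolem_spec_def fml.case using w r d by blast
      then show ?thesis by blast
    next
      case False
      then obtain v a where "v \<in> worlds K" "acc K w v" "a \<in> indiv K v" "\<not> val K v (\<rho>(x := a)) \<beta>"
        unfolding All val.simps by blast
      then have "skolem_spec K w \<rho> \<alpha> v a"
        unfolding All skolem_spec_def fml.case by blast
      then show ?thesis by blast
    qed
  next
    case (Ex x \<beta>)
    show ?thesis
    proof (cases "val K w \<rho> \<alpha>")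
      case True
      then obtain a where "a \<in> indiv K w" "val K w (\<rho>(x := a)) \<beta>"
        unfolding Ex val.simps by blast
      then have "skolem_spec K w \<rho> \<alpha> w a"
        unfolding Ex skolem_spec_def fml.case using w r by blast
      then show ?thesis by blast
    next
      case False
      then have "skolem_spec K w \<rho> \<alpha> w d"
        unfolding Ex skolem_spec_def fml.case using w r d by blast
      then show ?thesis by blast
    qed
  qed
  then show ?thesis by simp
qed

definition skolem ::
    "('w, 'd, 'p) kripke \<Rightarrow> 'w \<Rightarrow> (var \<Rightarrow> 'd) \<Rightarrow> ('s, 'p) fml \<Rightarrow> 'w \<times> 'd" where
  "skolem K w \<rho> \<alpha> = (SOME z. skolem_spec K w \<rho> \<alpha> (fst z) (snd z))"

lemma skolem_spec_skolem:
  assumes "kripke_model K" "w \<in> worlds K"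
  shows "skolem_spec K w \<rho> \<alpha> (fst (skolem K w \<rho> \<alpha>)) (snd (skolem K w \<rho> \<alpha>))"
  unfolding skolem_def by (rule someI_ex[OF skolem_spec_ex[OF assms]])

definition list_assign :: "'d list \<Rightarrow> var \<Rightarrow> 'd" where
  "list_assign ds i = (if i < length ds then ds ! i else undefined)"

text \<open>
  Formulas serve as Skolem terms: \<open>Conn c (\<alpha> # t # ts)\<close> denotes the result of the Skolem
  function for \<open>\<alpha>\<close> at the world denoted by \<open>t\<close> and the individuals denoted by \<open>ts\<close>.
\<close>

fun denot :: "('w, 'd, 'p) kripke \<Rightarrow> 'w \<Rightarrow> (var \<Rightarrow> 'd) \<Rightarrow> ('s, 'p) fml \<Rightarrow> 'w \<times> 'd" where
  "denot K w0 \<rho>0 (Conn c (\<alpha> # t # ts)) =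
     skolem K (fst (denot K w0 \<rho>0 t)) (list_assign (map (\<lambda>s. snd (denot K w0 \<rho>0 s)) ts)) \<alpha>"
| "denot K w0 \<rho>0 (All x \<alpha>) = (w0, \<rho>0 x)"
| "denot K w0 \<rho>0 t = (w0, \<rho>0 0)"

definition term_model ::
    "('w, 'd, 'p) kripke \<Rightarrow> 'w \<Rightarrow> (var \<Rightarrow> 'd) \<Rightarrow> (('s, 'p) fml, ('s, 'p) fml, 'p) kripke" where
  "term_model K w0 \<rho>0 =
     \<lparr>worlds = {t. fst (denot K w0 \<rho>0 t) \<in> worlds K},
      acc = (\<lambda>t u. acc K (fst (denot K w0 \<rho>0 t)) (fst (denot K w0 \<rho>0 u))),
      indiv = (\<lambda>t. {s. snd (denot K w0 \<rho>0 s) \<in> indiv K (fst (denot K w0 \<rho>0 t))}),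
      interp = (\<lambda>t p ss. interp K (fst (denot K w0 \<rho>0 t)) p (map (\<lambda>s. snd (denot K w0 \<rho>0 s)) ss))\<rparr>"

context
  fixes K :: "('w, 'd, 'p) kripke" and w0 :: 'w and \<rho>0 :: "var \<Rightarrow> 'd"
    and T :: "(('s, 'p) fml, ('s, 'p) fml, 'p) kripke"
    and dw :: "('s, 'p) fml \<Rightarrow> 'w" and di :: "('s, 'p) fml \<Rightarrow> 'd"
  assumes K: "kripke_model K" and w0: "w0 \<in> worlds K" and \<rho>0: "range \<rho>0 \<subseteq> indiv K w0"
  defines "T \<equiv> term_model K w0 \<rho>0"
    and "dw \<equiv> \<lambda>t. fst (denot K w0 \<rho>0 t)" and "di \<equiv> \<lambda>t. snd (denot K w0 \<rho>0 t)"
begin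

lemma term_model_simps:
  "worlds T = {t. dw t \<in> worlds K}"
  "acc T t u = acc K (dw t) (dw u)"
  "indiv T t = {s. di s \<in> indiv K (dw t)}"
  "interp T t p ss = interp K (dw t) p (map di ss)"
  by (simp_all add: T_def term_model_def dw_def di_def)

lemma skolem_term_ex:
  fixes \<sigma> :: "var \<Rightarrow> ('s, 'p) fml" and \<alpha> :: "('s, 'p) fml"
  assumes t: "dw t \<in> worlds K"
  shows "\<exists>u. skolem_spec K (dw t) (di \<circ> \<sigma>) \<alpha> (dw u) (di u)"
proof -
  define n where "n = Suc (Max (insert 0 (FV \<alpha>)))"
  have n: "i < n" if "i \<in> FV \<alpha>" for i
    using that finite_FV[of \<alpha>] by (auto simp: n_def less_Suc_eq_le)
  define \<tau> where "\<tau> = list_assign (map (di \<circ> \<sigma>) [0..<n])"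
  define u :: "('s, 'p) fml" where "u = Conn undefined (\<alpha> # t # map \<sigma> [0..<n])"
  have \<tau>: "\<tau> i = (di \<circ> \<sigma>) i" if "i \<in> FV \<alpha>" for i
    using n[OF that] by (simp add: \<tau>_def list_assign_def)
  have den: "denot K w0 \<rho>0 u = skolem K (dw t) \<tau> \<alpha>"
    by (simp add: u_def \<tau>_def dw_def di_def comp_def)
  have spec: "skolem_spec K (dw t) \<tau> \<alpha> (dw u) (di u)"
    using skolem_spec_skolem[OF K t, of \<tau> \<alpha>] by (simp add: den dw_def di_def)
  have val: "val K v \<tau> \<alpha> = val K v (di \<circ> \<sigma>) \<alpha>" for v
    by (rule val_cong) (rule \<tau>)
  have "skolem_spec K (dw t) (di \<circ> \<sigma>) \<alpha> (dw u) (di u)"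
  proof (cases \<alpha>)
    case (Atom p xs)
    show ?thesis using spec unfolding Atom skolem_spec_def fml.case .
  next
    case (Conn c \<alpha>s)
    have *: "map (val K v \<tau>) \<alpha>s = map (val K v (di \<circ> \<sigma>)) \<alpha>s" for v
      by (rule map_cong[OF refl], rule val_cong, rule \<tau>) (auto simp: Conn)
    show ?thesis using spec val[of "dw t"] unfolding Conn skolem_spec_def fml.case * by blast
  next
    case (All x \<beta>)
    have *: "val K v (\<tau>(x := a)) \<beta> = val K v ((di \<circ> \<sigma>)(x := a)) \<beta>" for v a
      by (rule val_cong) (use \<tau> All in auto)
    show ?thesis using spec val[of "dw t"] unfolding All skolem_spec_def fml.case * by blast
  next
    case (Ex x \<beta>)
    have *: "val K v (\<tau>(x := a)) \<beta> = val K v ((di \<circ> \<sigma>)(x := a)) \<beta>" for v a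
      by (rule val_cong) (use \<tau> Ex in auto)
    show ?thesis using spec val[of "dw t"] unfolding Ex skolem_spec_def fml.case * by blast
  qed
  then show ?thesis ..
qed

lemma kripke_model_term_model: "kripke_model T"
proof -
  have "\<exists>s. di s \<in> indiv K (dw t)" if t: "dw t \<in> worlds K" for t :: "('s, 'p) fml"
  proof -
    obtain u where "skolem_spec K (dw t) (di \<circ> (\<lambda>_. t)) (Atom undefined [] :: ('s, 'p) fml)
        (dw u) (di u)"
      using skolem_term_ex[OF t] by meson
    then show ?thesis by (auto simp: skolem_spec_def)
  qed
  then have "\<forall>t\<in>worlds T. indiv T t \<noteq> {}" by (auto simp: term_model_simps)
  moreover have "interp T t p as \<le> interp T u p as"
    if "t \<in> worlds T" "u \<in> worlds T" "acc T t u" "length as = pred_arity p" "set as \<subseteq> indiv T t"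
    for t u p as
  proof -
    have "length (map di as) = pred_arity p" "set (map di as) \<subseteq> indiv K (dw t)"
      using that by (auto simp: term_model_simps)
    then show ?thesis
      using K that(1-3) unfolding kripke_model_def term_model_simps mem_Collect_eq by blast
  qed
  moreover have "\<forall>t\<in>worlds T. acc T t t"
    using K unfolding kripke_model_def term_model_simps by simp
  moreover have "acc T t v"
    if "t \<in> worlds T" "u \<in> worlds T" "v \<in> worlds T" "acc T t u" "acc T u v" for t u v
    using K that unfolding kripke_model_def term_model_simps mem_Collect_eq by meson
  moreover have "indiv T t \<subseteq> indiv T u"
    if "t \<in> worlds T" "u \<in> worlds T" "acc T t u" for t u
    using K that unfolding kripke_model_def term_model_simps mem_Collect_eq by blast
  ultimately show ?thesis
    unfolding kripke_model_def by (intro conjI ballI allI impI) (assumption | blast)+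
qed

lemma constant_domain_term_model: "constant_domain K \<Longrightarrow> constant_domain T"
  unfolding constant_domain_def term_model_simps by blast

lemma val_term_model:
  fixes \<alpha> :: "('s, 'p) fml"
  assumes "t \<in> worlds T"
  shows "val T t \<sigma> \<alpha> = val K (dw t) (di \<circ> \<sigma>) \<alpha>"
  using assms
proof (induction \<alpha> arbitrary: t \<sigma>)
  case (Atom p xs)
  then show ?case by (simp add: term_model_simps comp_def)
next
  case (Conn c \<alpha>s)
  have t: "dw t \<in> worlds K" using Conn.prems by (simp add: term_model_simps)
  have map: "map (val T u \<sigma>) \<alpha>s = map (val K (dw u) (di \<circ> \<sigma>)) \<alpha>s" if "u \<in> worlds T" for u
    by (rule map_cong[OF refl], rule Conn.IH) (use that in auto)
  obtain u where "skolem_spec K (dw t) (di \<circ> \<sigma>) (Conn c \<alpha>s) (dw u) (di u)"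
    using skolem_term_ex[OF t, of \<sigma> "Conn c \<alpha>s"] by blast
  then have u: "dw u \<in> worlds K" "acc K (dw t) (dw u)"
    "val K (dw t) (di \<circ> \<sigma>) (Conn c \<alpha>s) \<or> \<not> truth_fun c (map (val K (dw u) (di \<circ> \<sigma>)) \<alpha>s)"
    unfolding skolem_spec_def fml.case by blast+
  have "val T t \<sigma> (Conn c \<alpha>s) \<longleftrightarrow> (\<forall>v. dw v \<in> worlds K \<longrightarrow> acc K (dw t) (dw v) \<longrightarrow>
      truth_fun c (map (val K (dw v) (di \<circ> \<sigma>)) \<alpha>s))"
    using map by (auto simp: term_model_simps simp del: map_eq_conv)
  also have "\<dots> \<longleftrightarrow> val K (dw t) (di \<circ> \<sigma>) (Conn c \<alpha>s)"
    using u by (auto simp del: map_eq_conv)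
  finally show ?case .
next
  case (All x \<alpha>)
  have t: "dw t \<in> worlds K" using All.prems by (simp add: term_model_simps)
  have IH: "val T v (\<sigma>(x := s)) \<alpha> = val K (dw v) ((di \<circ> \<sigma>)(x := di s)) \<alpha>"
    if "v \<in> worlds T" for v s
    using All.IH[OF that, of "\<sigma>(x := s)"] by (simp only: fun_upd_comp)
  obtain u where "skolem_spec K (dw t) (di \<circ> \<sigma>) (All x \<alpha>) (dw u) (di u)"
    using skolem_term_ex[OF t, of \<sigma> "All x \<alpha>"] by blast
  then have u: "dw u \<in> worlds K" "acc K (dw t) (dw u)" "di u \<in> indiv K (dw u)"
    "val K (dw t) (di \<circ> \<sigma>) (All x \<alpha>) \<or> \<not> val K (dw u) ((di \<circ> \<sigma>)(x := di u)) \<alpha>"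
    unfolding skolem_spec_def fml.case by blast+
  have "val T t \<sigma> (All x \<alpha>) \<longleftrightarrow> (\<forall>v. dw v \<in> worlds K \<longrightarrow> acc K (dw t) (dw v) \<longrightarrow>
      (\<forall>s. di s \<in> indiv K (dw v) \<longrightarrow> val K (dw v) ((di \<circ> \<sigma>)(x := di s)) \<alpha>))"
    using IH by (simp add: term_model_simps)
  also have "\<dots> \<longleftrightarrow> val K (dw t) (di \<circ> \<sigma>) (All x \<alpha>)"
    using u by auto
  finally show ?case .
next
  case (Ex x \<alpha>)
  have t: "dw t \<in> worlds K" using Ex.prems by (simp add: term_model_simps)
  have IH: "val T v (\<sigma>(x := s)) \<alpha> = val K (dw v) ((di \<circ> \<sigma>)(x := di s)) \<alpha>"
    if "v \<in> worlds T" for v s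
    using Ex.IH[OF that, of "\<sigma>(x := s)"] by (simp only: fun_upd_comp)
  obtain u where "skolem_spec K (dw t) (di \<circ> \<sigma>) (Ex x \<alpha>) (dw u) (di u)"
    using skolem_term_ex[OF t, of \<sigma> "Ex x \<alpha>"] by blast
  then have u: "dw u = dw t" "di u \<in> indiv K (dw u)"
    "val K (dw t) (di \<circ> \<sigma>) (Ex x \<alpha>) \<longrightarrow> val K (dw u) ((di \<circ> \<sigma>)(x := di u)) \<alpha>"
    unfolding skolem_spec_def fml.case by blast+
  have "val T t \<sigma> (Ex x \<alpha>) \<longleftrightarrow>
      (\<exists>s. di s \<in> indiv K (dw t) \<and> val K (dw t) ((di \<circ> \<sigma>)(x := di s)) \<alpha>)"
    using IH Ex.prems by (simp add: term_model_simps)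
  also have "\<dots> \<longleftrightarrow> val K (dw t) (di \<circ> \<sigma>) (Ex x \<alpha>)"
    using u by auto
  finally show ?case .
qed

lemma sequent_val_if_valid_term_model:
  fixes S :: "('s, 'p) sequent"
  assumes "valid T S"
  shows "sequent_val K w0 \<rho>0 S"
proof -
  define \<sigma> where "\<sigma> = (\<lambda>x. All x (Atom undefined []) :: ('s, 'p) fml)"
  have dw: "dw (\<sigma> 0) = w0" and di: "di \<circ> \<sigma> = \<rho>0"
    by (auto simp: \<sigma>_def dw_def di_def)
  have "range \<sigma> \<subseteq> indiv T (\<sigma> 0)"
    using \<rho>0 dw fun_cong[OF di] by (auto simp: term_model_simps)
  moreover have *: "\<sigma> 0 \<in> worlds T" using w0 dw by (simp add: term_model_simps)
  ultimately have "sequent_val T (\<sigma> 0) \<sigma> S"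
    using assms by (auto simp: valid_def)
  then show ?thesis
    by (simp add: sequent_val_def val_term_model[OF *] dw di)
qed

end

theorem FOILS_all_models:
  fixes S :: "('s, 'p) sequent" and K :: "('w, 'd, 'p) kripke"
  assumes "S \<in> FOILS C" "kripke_model K"
  shows "valid K S"
  unfolding valid_def
proof (intro ballI allI impI)
  fix w and \<rho> :: "var \<Rightarrow> 'd" assume w: "w \<in> worlds K" "range \<rho> \<subseteq> indiv K w"
  let ?T = "term_model K w \<rho> :: (('s, 'p) fml, ('s, 'p) fml, 'p) kripke"
  have "kripke_model ?T"
    by (rule kripke_model_term_model[OF assms(2) w])
  then have "valid ?T S"
    using assms(1) by (simp add: FOILS_def)
  then show "sequent_val K w \<rho> S"
    by (rule sequent_val_if_valid_term_model[OF assms(2) w])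
qed

theorem FOCDS_all_models:
  fixes S :: "('s, 'p) sequent" and K :: "('w, 'd, 'p) kripke"
  assumes "S \<in> FOCDS C" "kripke_model K" "constant_domain K"
  shows "valid K S"
  unfolding valid_def
proof (intro ballI allI impI)
  fix w and \<rho> :: "var \<Rightarrow> 'd" assume w: "w \<in> worlds K" "range \<rho> \<subseteq> indiv K w"
  let ?T = "term_model K w \<rho> :: (('s, 'p) fml, ('s, 'p) fml, 'p) kripke"
  have "kripke_model ?T" "constant_domain ?T"
    by (rule kripke_model_term_model[OF assms(2) w]
        constant_domain_term_model[OF assms(2) w assms(3)])+
  then have "valid ?T S"
    using assms(1) by (simp add: FOCDS_def)
  then show "sequent_val K w \<rho> S"
    by (rule sequent_val_if_valid_term_model[OF assms(2) w])
qed

end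

theory Submission
  imports Defs "HOL-Library.Sublist"
begin

text \<open>
  If every connective is supermultiplicative, a Kripke model with root \<open>w0\<close> is turned into a
  constant domain model whose worlds are the weakly increasing finite paths from \<open>w0\<close>.  Its
  individuals are threads, which pick an individual at every path of some fixed length \<open>N\<close> and
  are undefined at shorter paths.  A formula holds at a path iff it holds in the given model at
  the last worlds of all extensions at which the threads involved are defined.  This survives
  connectives because their truth sets are closed under nonempty meets, and existential
  quantifiers because witnesses at incomparable paths can be glued to a single thread.  Since a
  path may repeat its last world, waiting for a thread to become defined loses no information.

  Conversely, if \<open>f\<^sub>c(a) = f\<^sub>c(b) = 1\<close> but \<open>f\<^sub>c(a \<sqinter> b) = 0\<close>, let \<open>c(x)\<close> be \<open>c\<close> applied to \<open>r\<close>, \<open>p(x)\<close>,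
  \<open>q(x)\<close>, \<open>s\<close> at the positions where \<open>(a, b)\<close> is \<open>(1, 1)\<close>, \<open>(1, 0)\<close>, \<open>(0, 1)\<close>, \<open>(0, 0)\<close>.  The sequent
  \<open>r, \<forall>x c(x) \<Rightarrow> \<forall>x p(x), \<exists>x q(x), s\<close> is valid in all constant domain models, but fails in a model
  with two worlds where a second individual, satisfying \<open>q\<close> but not \<open>p\<close>, is born later.
\<close>

subsection \<open>Supermultiplicative connectives\<close>

lemma meet_map: "meet (map f xs) (map g xs) = map (\<lambda>x. f x \<and> g x) xs"
  by (induction xs) (auto simp: meet_def min_def)

text \<open>The binary condition iterates over any finite nonempty family. The empty meet is the
  all-true list, which \<open>c\<close> need not accept.\<close>

lemma supermultiplicative_finite_meet:
  assumes c: "supermultiplicative c" and len: "length xs = arity c"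
    and "finite J" "J \<noteq> {}" "\<And>j. j \<in> J \<Longrightarrow> truth_fun c (map (g j) xs)"
  shows "truth_fun c (map (\<lambda>x. \<forall>j\<in>J. g j x) xs)"
  using assms(3-)
proof (induction J rule: finite_ne_induct)
  case (singleton j)
  then show ?case by simp
next
  case (insert j J)
  then have "truth_fun c (meet (map (g j) xs) (map (\<lambda>x. \<forall>j\<in>J. g j x) xs))"
    using c len unfolding supermultiplicative_def by simp
  then show ?case by (simp add: meet_map)
qed

text \<open>Only the finitely many positions of \<open>xs\<close> matter: one index that fails at a
  position, if there is any, already decides the meet there, so a finite subfamily has the same
  meet.\<close>

lemma supermultiplicative_meet:
  assumes c: "supermultiplicative c" and len: "length xs = arity c"
    and ne: "I \<noteq> {}" and I: "\<And>i. i \<in> I \<Longrightarrow> truth_fun c (map (g i) xs)"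
  shows "truth_fun c (map (\<lambda>x. \<forall>i\<in>I. g i x) xs)"
proof -
  obtain i0 where i0: "i0 \<in> I" using ne by blast
  define k where "k x = (if \<exists>i\<in>I. \<not> g i x then SOME i. i \<in> I \<and> \<not> g i x else i0)" for x
  have k: "k x \<in> I \<and> (g (k x) x \<longrightarrow> (\<forall>i\<in>I. g i x))" for x
  proof (cases "\<exists>i\<in>I. \<not> g i x")
    case True
    then have "\<exists>i. i \<in> I \<and> \<not> g i x" by blast
    from someI_ex[OF this] True show ?thesis unfolding k_def by auto
  qed (auto simp: k_def i0)
  \<comment> \<open>The index \<open>i0\<close> keeps \<open>J\<close> nonempty when
    \<open>c\<close> has arity 0.\<close>
  define J where "J = insert i0 (k ` set xs)"
  have "J \<subseteq> I" using i0 k by (auto simp: J_def)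
  moreover have "finite J" "J \<noteq> {}" by (auto simp: J_def)
  ultimately have "truth_fun c (map (\<lambda>x. \<forall>j\<in>J. g j x) xs)"
    using I by (intro supermultiplicative_finite_meet[OF c len]) auto
  moreover have "(\<forall>j\<in>J. g j x) = (\<forall>i\<in>I. g i x)" if "x \<in> set xs" for x
    using that k[of x] \<open>J \<subseteq> I\<close> unfolding J_def by blast
  then have "map (\<lambda>x. \<forall>j\<in>J. g j x) xs = map (\<lambda>x. \<forall>i\<in>I. g i x) xs"
    by simp
  ultimately show ?thesis by simp
qed

subsection \<open>The constant domain model of paths and threads\<close>

text \<open>\<open>Conn\<close> and \<open>All\<close> look at all later worlds, so transitivity
  settles them. Only \<open>Ex\<close> needs the induction hypothesis, together with the growth of
  the domains.\<close>

lemma val_persistent: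
  assumes K: "kripke_model K" and "\<alpha> \<in> Fml C"
    and w: "w \<in> worlds K" and v: "v \<in> worlds K" and wv: "acc K w v"
    and "\<rho> ` FV \<alpha> \<subseteq> indiv K w" "val K w \<rho> \<alpha>"
  shows "val K v \<rho> \<alpha>"
proof -
  note K' = K[unfolded kripke_model_def]
  have tr: "acc K w u" if "acc K v u" "u \<in> worlds K" for u
    by (rule K'[THEN conjunct2, THEN conjunct1, rule_format, OF w v that(2) wv that(1)])
  have mono: "indiv K w \<subseteq> indiv K v"
    using K' w v wv by blast
  have interp: "interp K w p as \<le> interp K v p as"
    if "length as = pred_arity p" "set as \<subseteq> indiv K w" for p as
    using K' w v wv that by blast
  show ?thesis
    using assms(2,6,7)
  proof (induction arbitrary: \<rho>)
    case (Atom xs p)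
    then show ?case using interp[of "map \<rho> xs" p] by simp
  next
    case (Conn c \<alpha>s)
    from Conn.prems(2) tr show ?case unfolding val.simps by blast
  next
    case (All \<alpha> x)
    from All.prems(2) tr show ?case unfolding val.simps by blast
  next
    case (Ex \<alpha> x)
    from Ex.prems(2) obtain a where a: "a \<in> indiv K w" "val K w (\<rho>(x := a)) \<alpha>" by auto
    have "(\<rho>(x := a)) ` FV \<alpha> \<subseteq> indiv K w" using Ex.prems(1) a(1) by auto
    then have "val K v (\<rho>(x := a)) \<alpha>" using Ex.IH a(2) by blast
    with a(1) mono show ?case by auto
  qed
qed

type_synonym ('w, 'd) thread = "nat \<times> ('w list \<Rightarrow> 'd)"

text \<open>Cutting the path back to length \<open>fst a\<close> freezes the chosen individual along
  all further extensions.\<close>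

definition thread_at :: "'w list \<Rightarrow> ('w, 'd) thread \<Rightarrow> 'd" where
  "thread_at \<tau> a = snd a (take (fst a) \<tau>)"

lemma thread_at_prefix:
  "prefix \<sigma> \<tau> \<Longrightarrow> fst a \<le> length \<sigma> \<Longrightarrow> thread_at \<tau> a = thread_at \<sigma> a"
  by (auto simp: thread_at_def prefix_def)

locale rooted_kripke =
  fixes K :: "('w, 'd, 'p) kripke" and w0 :: 'w
  assumes K: "kripke_model K" and w0: "w0 \<in> worlds K"
begin

lemma acc_refl: "w \<in> worlds K \<Longrightarrow> acc K w w"
  and acc_trans: "u \<in> worlds K \<Longrightarrow> v \<in> worlds K \<Longrightarrow> w \<in> worlds K \<Longrightarrow>
    acc K u v \<Longrightarrow> acc K v w \<Longrightarrow> acc K u w"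
  and indiv_nonempty: "w \<in> worlds K \<Longrightarrow> \<exists>a. a \<in> indiv K w"
  and indiv_mono: "w \<in> worlds K \<Longrightarrow> v \<in> worlds K \<Longrightarrow> acc K w v \<Longrightarrow> indiv K w \<subseteq> indiv K v"
proof -
  note * = K[unfolded kripke_model_def]
  show "w \<in> worlds K \<Longrightarrow> acc K w w" using * by blast
  show "u \<in> worlds K \<Longrightarrow> v \<in> worlds K \<Longrightarrow> w \<in> worlds K \<Longrightarrow>
    acc K u v \<Longrightarrow> acc K v w \<Longrightarrow> acc K u w"
    by (rule *[THEN conjunct2, THEN conjunct1, rule_format])
  show "w \<in> worlds K \<Longrightarrow> \<exists>a. a \<in> indiv K w" using * by blast
  show "w \<in> worlds K \<Longrightarrow> v \<in> worlds K \<Longrightarrow> acc K w v \<Longrightarrow> indiv K w \<subseteq> indiv K v" using * by blast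
qed

section \<open>Weakly increasing paths from the root\<close>

definition paths :: "'w list set" where
  "paths = {\<tau>. \<tau> \<noteq> [] \<and> hd \<tau> = w0 \<and> sorted_wrt (acc K) \<tau> \<and> set \<tau> \<subseteq> worlds K}"

lemma root_in_paths: "[w0] \<in> paths"
  using w0 by (simp add: paths_def)

lemma last_path_in_worlds: "\<tau> \<in> paths \<Longrightarrow> last \<tau> \<in> worlds K"
  by (auto simp: paths_def)

lemma path_acc_last:
  assumes "\<tau> \<in> paths" "w \<in> set \<tau>"
  shows "acc K w (last \<tau>)"
proof -
  have ne: "\<tau> \<noteq> []" and w: "w \<in> worlds K" using assms by (auto simp: paths_def)
  have "sorted_wrt (acc K) (butlast \<tau> @ [last \<tau>])" "w \<in> set (butlast \<tau> @ [last \<tau>])"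
    using assms ne by (simp_all add: paths_def)
  then show ?thesis
    using acc_refl[OF w] by (auto simp: sorted_wrt_append)
qed

text \<open>\<open>sorted_wrt\<close> compares every pair of entries, so transitivity is needed to
  get from the last world back to the earlier ones.\<close>

lemma path_snoc:
  assumes "\<tau> \<in> paths" "v \<in> worlds K" "acc K (last \<tau>) v"
  shows "\<tau> @ [v] \<in> paths"
proof -
  have "acc K w v" if "w \<in> set \<tau>" for w
    by (rule acc_trans[OF _ last_path_in_worlds assms(2) path_acc_last assms(3)])
      (use that assms(1) in \<open>auto simp: paths_def\<close>)
  then show ?thesis using assms by (auto simp: paths_def sorted_wrt_append)
qed

lemma path_take: "\<tau> \<in> paths \<Longrightarrow> 1 \<le> n \<Longrightarrow> take n \<tau> \<in> paths"
  by (auto simp: paths_def sorted_wrt_take dest: in_set_takeD)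

lemma path_prefix_acc:
  assumes "\<sigma> \<in> paths" "\<tau> \<in> paths" "prefix \<sigma> \<tau>"
  shows "acc K (last \<sigma>) (last \<tau>)"
proof -
  have "last \<sigma> \<in> set \<sigma>" using assms by (auto simp: paths_def)
  then show ?thesis using path_acc_last[OF assms(2)] set_mono_prefix[OF assms(3)] by blast
qed

text \<open>By reflexivity the last world can be repeated, which gains length without changing the
  world of evaluation.\<close>

lemma path_stay:
  assumes "\<tau> \<in> paths"
  shows "\<exists>\<tau>'\<in>paths. prefix \<tau> \<tau>' \<and> n \<le> length \<tau>' \<and> last \<tau>' = last \<tau>"
proof (induction n)
  case 0
  then show ?case using assms by auto
next
  case (Suc n)
  then obtain \<tau>' where t: "\<tau>' \<in> paths" "prefix \<tau> \<tau>'" "n \<le> length \<tau>'" "last \<tau>' = last \<tau>" by blast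
  have "\<tau>' @ [last \<tau>] \<in> paths"
    using path_snoc[OF t(1), of "last \<tau>"] t(4) acc_refl last_path_in_worlds[OF assms] by simp
  with t show ?case by (intro bexI[of _ "\<tau>' @ [last \<tau>]"]) (auto simp: prefix_def)
qed

section \<open>Threads and assignments of threads\<close>

definition threads :: "('w, 'd) thread set" where
  "threads = {a. 1 \<le> fst a \<and> (\<forall>\<tau>\<in>paths. length \<tau> = fst a \<longrightarrow> snd a \<tau> \<in> indiv K (last \<tau>))}"

lemma thread_at_in_indiv:
  assumes "a \<in> threads" "\<tau> \<in> paths" "fst a \<le> length \<tau>"
  shows "thread_at \<tau> a \<in> indiv K (last \<tau>)"
proof -
  let ?t = "take (fst a) \<tau>"
  \<comment> \<open>The bound \<open>1 \<le> fst a\<close> in \<open>threads\<close> keeps this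
    truncation nonempty, hence a path.\<close>
  have t: "?t \<in> paths" using assms by (intro path_take) (auto simp: threads_def)
  then have "thread_at \<tau> a \<in> indiv K (last ?t)"
    using assms by (auto simp: threads_def thread_at_def)
  then show ?thesis
    using indiv_mono[OF last_path_in_worlds[OF t] last_path_in_worlds[OF assms(2)]]
      path_prefix_acc[OF t assms(2) take_is_prefix] by blast
qed

definition defined_on :: "var set \<Rightarrow> (var \<Rightarrow> ('w, 'd) thread) \<Rightarrow> 'w list \<Rightarrow> bool" where
  "defined_on F \<rho> \<tau> \<longleftrightarrow> (\<forall>x\<in>F. fst (\<rho> x) \<le> length \<tau>)"

lemma defined_on_prefix: "defined_on F \<rho> \<sigma> \<Longrightarrow> prefix \<sigma> \<tau> \<Longrightarrow> defined_on F \<rho> \<tau>"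
  using prefix_length_le unfolding defined_on_def by fastforce

lemma defined_on_subset: "defined_on F \<rho> \<tau> \<Longrightarrow> G \<subseteq> F \<Longrightarrow> defined_on G \<rho> \<tau>"
  unfolding defined_on_def by blast

lemma defined_on_upd:
  "defined_on F (\<rho>(x := a)) \<tau> \<longleftrightarrow>
     (x \<in> F \<longrightarrow> fst a \<le> length \<tau>) \<and> defined_on (F - {x}) \<rho> \<tau>"
  unfolding defined_on_def by (metis Diff_iff fun_upd_apply singletonD singletonI)

lemma path_stay_defined:
  assumes "\<tau> \<in> paths" "finite F"
  shows "\<exists>\<tau>'\<in>paths. prefix \<tau> \<tau>' \<and> defined_on F \<rho> \<tau>' \<and> last \<tau>' = last \<tau>"
proof -
  obtain n where "\<forall>x\<in>F. fst (\<rho> x) \<le> n"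
    using finite_nat_set_iff_bounded_le[of "(\<lambda>x. fst (\<rho> x)) ` F"] assms(2) by auto
  then show ?thesis
    using path_stay[OF assms(1), of n] unfolding defined_on_def by (meson order_trans)
qed

definition assign_at :: "(var \<Rightarrow> ('w, 'd) thread) \<Rightarrow> 'w list \<Rightarrow> var \<Rightarrow> 'd" where
  "assign_at \<rho> \<tau> x = thread_at \<tau> (\<rho> x)"

lemma assign_at_upd: "assign_at (\<rho>(x := a)) \<tau> = (assign_at \<rho> \<tau>)(x := thread_at \<tau> a)"
  by (auto simp: assign_at_def)

lemma assign_at_prefix:
  "defined_on F \<rho> \<sigma> \<Longrightarrow> prefix \<sigma> \<tau> \<Longrightarrow> x \<in> F \<Longrightarrow> assign_at \<rho> \<tau> x = assign_at \<rho> \<sigma> x"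
  by (simp add: defined_on_def assign_at_def thread_at_prefix)

lemma assign_at_in_indiv:
  "range \<rho> \<subseteq> threads \<Longrightarrow> \<tau> \<in> paths \<Longrightarrow> defined_on F \<rho> \<tau> \<Longrightarrow> assign_at \<rho> \<tau> ` F \<subseteq> indiv K (last \<tau>)"
  by (auto simp: defined_on_def assign_at_def intro!: thread_at_in_indiv)

text \<open>Atoms quantify over all extensions, so their monotonicity is just the transitivity of
  \<open>prefix\<close>.\<close>

definition thread_model :: "('w list, ('w, 'd) thread, 'p) kripke" where
  "thread_model = \<lparr>worlds = paths, acc = prefix, indiv = (\<lambda>_. threads),
     interp = (\<lambda>\<sigma> p as. \<forall>\<tau>\<in>paths. prefix \<sigma> \<tau> \<longrightarrow> (\<forall>a\<in>set as. fst a \<le> length \<tau>) \<longrightarrow>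
        interp K (last \<tau>) p (map (thread_at \<tau>) as))\<rparr>"

lemma thread_model_simps [simp]:
  "worlds thread_model = paths"
  "acc thread_model = prefix"
  "indiv thread_model \<sigma> = threads"
  "interp thread_model \<sigma> p as \<longleftrightarrow>
     (\<forall>\<tau>\<in>paths. prefix \<sigma> \<tau> \<longrightarrow> (\<forall>a\<in>set as. fst a \<le> length \<tau>) \<longrightarrow>
        interp K (last \<tau>) p (map (thread_at \<tau>) as))"
  by (simp_all add: thread_model_def)

lemma some_indiv: "\<tau> \<in> paths \<Longrightarrow> (SOME e. e \<in> indiv K (last \<tau>)) \<in> indiv K (last \<tau>)"
  using indiv_nonempty[OF last_path_in_worlds] by (rule someI_ex)

lemma kripke_model_thread_model: "kripke_model thread_model"
proof -
  have "(1, \<lambda>\<tau>. SOME e. e \<in> indiv K (last \<tau>)) \<in> threads"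
    using some_indiv by (auto simp: threads_def)
  then show ?thesis
    unfolding kripke_model_def by (auto intro: prefix_order.trans)
qed

lemma constant_domain_thread_model: "constant_domain thread_model"
  by (simp add: constant_domain_def)

section \<open>Truth at all sufficiently long extensions\<close>

definition forced :: "var set \<Rightarrow> 'w list \<Rightarrow> (var \<Rightarrow> ('w, 'd) thread) \<Rightarrow> ('s, 'p) fml \<Rightarrow> bool" where
  "forced F \<sigma> \<rho> \<alpha> \<longleftrightarrow> (\<forall>\<tau>\<in>paths. prefix \<sigma> \<tau> \<longrightarrow> defined_on F \<rho> \<tau> \<longrightarrow>
     val K (last \<tau>) (assign_at \<rho> \<tau>) \<alpha>)"

text \<open>Repeating the last world until \<open>F\<close> is defined changes neither the world nor
  the individuals assigned to \<open>FV \<alpha>\<close>. Thus all arguments of a connective can be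
  treated over one common set of variables.\<close>

lemma forced_superset:
  assumes "finite F" "FV \<alpha> \<subseteq> F"
  shows "forced F \<sigma> \<rho> \<alpha> \<longleftrightarrow> forced (FV \<alpha>) \<sigma> \<rho> \<alpha>"
proof
  assume f: "forced F \<sigma> \<rho> \<alpha>"
  show "forced (FV \<alpha>) \<sigma> \<rho> \<alpha>"
    unfolding forced_def
  proof (intro ballI impI)
    fix \<tau> assume t: "\<tau> \<in> paths" "prefix \<sigma> \<tau>" "defined_on (FV \<alpha>) \<rho> \<tau>"
    obtain \<tau>' where t': "\<tau>' \<in> paths" "prefix \<tau> \<tau>'" "defined_on F \<rho> \<tau>'" "last \<tau>' = last \<tau>"
      using path_stay_defined[OF t(1) assms(1)] by blast
    have "val K (last \<tau>') (assign_at \<rho> \<tau>') \<alpha>"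
      using f t t' prefix_order.trans unfolding forced_def by blast
    also have "val K (last \<tau>') (assign_at \<rho> \<tau>') \<alpha> = val K (last \<tau>') (assign_at \<rho> \<tau>) \<alpha>"
      by (rule val_cong) (rule assign_at_prefix[OF t(3) t'(2)])
    finally show "val K (last \<tau>) (assign_at \<rho> \<tau>) \<alpha>" by (simp only: t'(4))
  qed
next
  assume "forced (FV \<alpha>) \<sigma> \<rho> \<alpha>"
  then show "forced F \<sigma> \<rho> \<alpha>"
    using defined_on_subset[OF _ assms(2)] unfolding forced_def by blast
qed

lemma val_path_prefix:
  assumes "\<alpha> \<in> Fml C" "range \<rho> \<subseteq> threads" "\<sigma> \<in> paths" "\<tau> \<in> paths" "prefix \<sigma> \<tau>"
    "defined_on (FV \<alpha>) \<rho> \<sigma>" "val K (last \<sigma>) (assign_at \<rho> \<sigma>) \<alpha>"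
  shows "val K (last \<tau>) (assign_at \<rho> \<tau>) \<alpha>"
proof -
  have "val K (last \<tau>) (assign_at \<rho> \<sigma>) \<alpha>"
    by (rule val_persistent[OF K assms(1) _ _ path_prefix_acc _ assms(7)])
      (use assms last_path_in_worlds assign_at_in_indiv in auto)
  also have "val K (last \<tau>) (assign_at \<rho> \<sigma>) \<alpha> = val K (last \<tau>) (assign_at \<rho> \<tau>) \<alpha>"
    by (rule val_cong) (simp add: assign_at_prefix[OF assms(6,5)])
  finally show ?thesis .
qed

text \<open>The path \<open>\<sigma>\<close> is itself one of the extensions concerned, and
  persistence takes care of the others.\<close>

lemma forced_defined:
  assumes "\<alpha> \<in> Fml C" "range \<rho> \<subseteq> threads" "\<sigma> \<in> paths" "defined_on (FV \<alpha>) \<rho> \<sigma>"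
  shows "forced (FV \<alpha>) \<sigma> \<rho> \<alpha> \<longleftrightarrow> val K (last \<sigma>) (assign_at \<rho> \<sigma>) \<alpha>"
  using val_path_prefix[OF assms(1-3) _ _ assms(4)] assms(3,4)
  unfolding forced_def by auto

text \<open>At each extension of \<open>\<tau>\<close> where all variables are defined,
  \<open>c\<close> accepts the list of argument values; the meet of these lists is the list of
  \<open>forced\<close> values, so supermultiplicativity applies. Conversely, an accessible world
  \<open>v\<close> is the end of the path \<open>\<tau> @ [v]\<close>, where forcing is
  truth.\<close>

lemma forced_Conn:
  assumes c: "supermultiplicative c" and len: "length \<alpha>s = arity c"
    and Fml: "\<And>\<alpha>. \<alpha> \<in> set \<alpha>s \<Longrightarrow> \<alpha> \<in> Fml C" and \<rho>: "range \<rho> \<subseteq> threads"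
  shows "forced (FV (Conn c \<alpha>s)) \<sigma> \<rho> (Conn c \<alpha>s) \<longleftrightarrow>
    (\<forall>\<tau>\<in>paths. prefix \<sigma> \<tau> \<longrightarrow> truth_fun c (map (\<lambda>\<alpha>. forced (FV \<alpha>) \<tau> \<rho> \<alpha>) \<alpha>s))"
    (is "forced ?F \<sigma> \<rho> ?\<beta> \<longleftrightarrow> ?R")
proof
  assume f: "forced ?F \<sigma> \<rho> ?\<beta>"
  show ?R
  proof (intro ballI impI)
    fix \<tau> assume t: "\<tau> \<in> paths" "prefix \<sigma> \<tau>"
    define I where "I = {\<tau>' \<in> paths. prefix \<tau> \<tau>' \<and> defined_on ?F \<rho> \<tau>'}"
    have "I \<noteq> {}"
      using path_stay_defined[OF t(1) finite_FV] unfolding I_def by blast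
    moreover have "truth_fun c (map (val K (last \<tau>') (assign_at \<rho> \<tau>')) \<alpha>s)" if "\<tau>' \<in> I" for \<tau>'
    proof -
      have "\<tau>' \<in> paths" "prefix \<sigma> \<tau>'" "defined_on ?F \<rho> \<tau>'"
        using that t prefix_order.trans unfolding I_def by blast+
      then have "val K (last \<tau>') (assign_at \<rho> \<tau>') ?\<beta>" "last \<tau>' \<in> worlds K"
        using f last_path_in_worlds unfolding forced_def by blast+
      then show ?thesis using acc_refl unfolding val.simps by blast
    qed
    ultimately have "truth_fun c (map (\<lambda>\<alpha>. \<forall>\<tau>'\<in>I. val K (last \<tau>') (assign_at \<rho> \<tau>') \<alpha>) \<alpha>s)"
      by (rule supermultiplicative_meet[OF c len])
    moreover have "(\<forall>\<tau>'\<in>I. val K (last \<tau>') (assign_at \<rho> \<tau>') \<alpha>) = forced (FV \<alpha>) \<tau> \<rho> \<alpha>"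
      if "\<alpha> \<in> set \<alpha>s" for \<alpha>
    proof -
      have "forced (FV \<alpha>) \<tau> \<rho> \<alpha> \<longleftrightarrow> forced ?F \<tau> \<rho> \<alpha>"
        using forced_superset[OF finite_FV[of ?\<beta>], of \<alpha>] that by auto
      also have "\<dots> \<longleftrightarrow> (\<forall>\<tau>'\<in>I. val K (last \<tau>') (assign_at \<rho> \<tau>') \<alpha>)"
        unfolding forced_def I_def by blast
      finally show ?thesis by simp
    qed
    ultimately show "truth_fun c (map (\<lambda>\<alpha>. forced (FV \<alpha>) \<tau> \<rho> \<alpha>) \<alpha>s)"
      by (simp cong: map_cong)
  qed
next
  assume R: ?R
  show "forced ?F \<sigma> \<rho> ?\<beta>"
    unfolding forced_def val.simps
  proof (intro ballI impI)
    fix \<tau> v assume t: "\<tau> \<in> paths" "prefix \<sigma> \<tau>" "defined_on ?F \<rho> \<tau>"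
      and v: "v \<in> worlds K" "acc K (last \<tau>) v"
    have t': "\<tau> @ [v] \<in> paths" by (rule path_snoc[OF t(1) v])
    have "truth_fun c (map (\<lambda>\<alpha>. forced (FV \<alpha>) (\<tau> @ [v]) \<rho> \<alpha>) \<alpha>s)"
      using R t' t(2) by simp
    moreover have "forced (FV \<alpha>) (\<tau> @ [v]) \<rho> \<alpha> = val K v (assign_at \<rho> \<tau>) \<alpha>"
      if a: "\<alpha> \<in> set \<alpha>s" for \<alpha>
    proof -
      have sub: "FV \<alpha> \<subseteq> ?F" using a by auto
      have d: "defined_on (FV \<alpha>) \<rho> \<tau>" using t(3) sub by (rule defined_on_subset)
      then have d': "defined_on (FV \<alpha>) \<rho> (\<tau> @ [v])" by (rule defined_on_prefix) simp
      have "forced (FV \<alpha>) (\<tau> @ [v]) \<rho> \<alpha> = val K v (assign_at \<rho> (\<tau> @ [v])) \<alpha>"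
        using forced_defined[OF Fml[OF a] \<rho> t' d'] by simp
      also have "\<dots> = val K v (assign_at \<rho> \<tau>) \<alpha>"
        by (rule val_cong) (rule assign_at_prefix[OF d], simp_all)
      finally show ?thesis .
    qed
    ultimately show "truth_fun c (map (val K v (assign_at \<rho> \<tau>)) \<alpha>s)"
      by (simp cong: map_cong)
  qed
qed

text \<open>From right to left, every individual of a later world has to be the value of some
  thread; a thread as long as the path that ends in this world can take any prescribed value
  there.\<close>

lemma forced_All:
  assumes Fml: "\<alpha> \<in> Fml C" and \<rho>: "range \<rho> \<subseteq> threads"
  shows "forced (FV (All x \<alpha>)) \<sigma> \<rho> (All x \<alpha>) \<longleftrightarrow>
    (\<forall>\<tau>\<in>paths. prefix \<sigma> \<tau> \<longrightarrow> (\<forall>a\<in>threads. forced (FV \<alpha>) \<tau> (\<rho>(x := a)) \<alpha>))"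
    (is "forced ?F \<sigma> \<rho> ?\<beta> \<longleftrightarrow> ?R")
proof
  assume f: "forced ?F \<sigma> \<rho> ?\<beta>"
  show ?R
  proof (intro ballI impI)
    fix \<tau> a assume t: "\<tau> \<in> paths" "prefix \<sigma> \<tau>" and a: "a \<in> threads"
    \<comment> \<open>The variable \<open>x\<close> is awaited even if it is not free in
      \<open>\<alpha>\<close>: only where \<open>a\<close> is defined is its value known to be an
      individual.\<close>
    have "forced (insert x (FV \<alpha>)) \<tau> (\<rho>(x := a)) \<alpha>"
      unfolding forced_def
    proof (intro ballI impI)
      fix \<tau>' assume t': "\<tau>' \<in> paths" "prefix \<tau> \<tau>'"
        and d: "defined_on (insert x (FV \<alpha>)) (\<rho>(x := a)) \<tau>'"
      have "defined_on ?F \<rho> \<tau>'" using d by (simp add: defined_on_upd)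
      then have "val K (last \<tau>') (assign_at \<rho> \<tau>') ?\<beta>"
        using f t t' prefix_order.trans unfolding forced_def by blast
      moreover have "thread_at \<tau>' a \<in> indiv K (last \<tau>')"
        using d by (intro thread_at_in_indiv a t') (simp add: defined_on_def)
      moreover have "last \<tau>' \<in> worlds K" using t'(1) by (rule last_path_in_worlds)
      ultimately show "val K (last \<tau>') (assign_at (\<rho>(x := a)) \<tau>') \<alpha>"
        using acc_refl unfolding assign_at_upd val.simps by blast
    qed
    then show "forced (FV \<alpha>) \<tau> (\<rho>(x := a)) \<alpha>"
      using forced_superset[of "insert x (FV \<alpha>)" \<alpha>] finite_FV by auto
  qed
next
  assume R: ?R
  show "forced ?F \<sigma> \<rho> ?\<beta>"
    unfolding forced_def val.simps
  proof (intro ballI impI)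
    fix \<tau> v e assume t: "\<tau> \<in> paths" "prefix \<sigma> \<tau>" "defined_on ?F \<rho> \<tau>"
      and v: "v \<in> worlds K" "acc K (last \<tau>) v" and e: "e \<in> indiv K v"
    let ?t = "\<tau> @ [v]"
    \<comment> \<open>The value \<open>e\<close> is prescribed at the path \<open>?t\<close> only;
      elsewhere any individual of the last world will do.\<close>
    define a where "a = (length ?t, \<lambda>t. if t = ?t then e else SOME e. e \<in> indiv K (last t))"
    have t': "?t \<in> paths" by (rule path_snoc[OF t(1) v])
    have a: "a \<in> threads"
      using e some_indiv by (auto simp: threads_def a_def)
    have ae: "thread_at ?t a = e" by (simp add: thread_at_def a_def)
    have d: "defined_on (FV \<alpha>) (\<rho>(x := a)) ?t"
      using defined_on_prefix[OF t(3), of ?t] by (simp add: defined_on_upd a_def)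
    have r: "range (\<rho>(x := a)) \<subseteq> threads" using \<rho> a by auto
    have "forced (FV \<alpha>) ?t (\<rho>(x := a)) \<alpha>"
      using R t' t(2) a by simp
    then have "val K v ((assign_at \<rho> ?t)(x := e)) \<alpha>"
      using forced_defined[OF Fml r t' d] by (simp add: assign_at_upd ae)
    also have "val K v ((assign_at \<rho> ?t)(x := e)) \<alpha> = val K v ((assign_at \<rho> \<tau>)(x := e)) \<alpha>"
      by (rule val_cong) (use assign_at_prefix[OF t(3), of ?t] in auto)
    finally show "val K v ((assign_at \<rho> \<tau>)(x := e)) \<alpha>" .
  qed
qed

text \<open>Distinct paths of equal length are incomparable, so witnesses can be chosen
  independently at all paths of one length \<open>N\<close> and glued to a single thread.
  Persistence carries them to longer paths.\<close>

lemma forced_Ex: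
  assumes Fml: "\<alpha> \<in> Fml C" and \<rho>: "range \<rho> \<subseteq> threads" and s: "\<sigma> \<in> paths"
  shows "forced (FV (Ex x \<alpha>)) \<sigma> \<rho> (Ex x \<alpha>) \<longleftrightarrow>
    (\<exists>a\<in>threads. forced (FV \<alpha>) \<sigma> (\<rho>(x := a)) \<alpha>)"
    (is "forced ?F \<sigma> \<rho> ?\<beta> \<longleftrightarrow> ?R")
proof
  assume f: "forced ?F \<sigma> \<rho> ?\<beta>"
  obtain n where n: "\<forall>y\<in>?F. fst (\<rho> y) \<le> n"
    using finite_nat_set_iff_bounded_le[of "(\<lambda>y. fst (\<rho> y)) ` ?F"] finite_FV[of ?\<beta>] by auto
  \<comment> \<open>The bound \<open>n\<close> makes the parameters defined at length
    \<open>N\<close>, and \<open>length \<sigma>\<close> ensures that truncations to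
    \<open>N\<close> still extend \<open>\<sigma>\<close>.\<close>
  define N where "N = max n (length \<sigma>)"
  \<comment> \<open>Without a witness any individual is accepted, since a thread also needs values
    at paths of length \<open>N\<close> that do not extend \<open>\<sigma>\<close>.\<close>
  define ok where "ok t e \<longleftrightarrow> e \<in> indiv K (last t) \<and>
    ((\<exists>e\<in>indiv K (last t). val K (last t) ((assign_at \<rho> t)(x := e)) \<alpha>) \<longrightarrow>
      val K (last t) ((assign_at \<rho> t)(x := e)) \<alpha>)" for t e
  define a where "a = (N, \<lambda>t. SOME e. ok t e)"
  have ok: "ok t (SOME e. ok t e)" if "t \<in> paths" for t
  proof (rule someI_ex)
    show "\<exists>e. ok t e"
      using indiv_nonempty[OF last_path_in_worlds[OF that]] unfolding ok_def by blast
  qed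
  have N: "1 \<le> N" using s by (cases \<sigma>) (auto simp: N_def paths_def)
  then have a: "a \<in> threads"
    using ok by (auto simp: threads_def a_def ok_def)
  then have r: "range (\<rho>(x := a)) \<subseteq> threads" using \<rho> by auto
  have "forced (insert x (FV \<alpha>)) \<sigma> (\<rho>(x := a)) \<alpha>"
    unfolding forced_def
  proof (intro ballI impI)
    fix \<tau> assume t: "\<tau> \<in> paths" "prefix \<sigma> \<tau>" and d: "defined_on (insert x (FV \<alpha>)) (\<rho>(x := a)) \<tau>"
    let ?t = "take N \<tau>"
    have len: "N \<le> length \<tau>" using d by (simp add: defined_on_def a_def)
    have t': "?t \<in> paths" by (rule path_take[OF t(1) N])
    have p: "prefix \<sigma> ?t" using t(2) by (auto simp: prefix_def N_def)
    have dF: "defined_on ?F \<rho> ?t"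
      unfolding defined_on_def using n len by (auto simp: N_def le_max_iff_disj simp del: FV.simps)
    then have d': "defined_on (FV \<alpha>) (\<rho>(x := a)) ?t"
      using len by (simp add: defined_on_upd a_def)
    have "\<exists>e\<in>indiv K (last ?t). val K (last ?t) ((assign_at \<rho> ?t)(x := e)) \<alpha>"
      using f t' p dF unfolding forced_def val.simps by blast
    then have "val K (last ?t) ((assign_at \<rho> ?t)(x := SOME e. ok ?t e)) \<alpha>"
      using ok[OF t'] unfolding ok_def by blast
    then have "val K (last ?t) (assign_at (\<rho>(x := a)) ?t) \<alpha>"
      by (simp add: assign_at_upd thread_at_def a_def)
    then show "val K (last \<tau>) (assign_at (\<rho>(x := a)) \<tau>) \<alpha>"
      by (rule val_path_prefix[OF Fml r t' t(1) take_is_prefix d'])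
  qed
  then have "forced (FV \<alpha>) \<sigma> (\<rho>(x := a)) \<alpha>"
    using forced_superset[of "insert x (FV \<alpha>)" \<alpha>] finite_FV by auto
  with a show ?R by blast
next
  assume ?R
  then obtain a where a: "a \<in> threads" and "forced (FV \<alpha>) \<sigma> (\<rho>(x := a)) \<alpha>" by blast
  then have f: "forced (insert x (FV \<alpha>)) \<sigma> (\<rho>(x := a)) \<alpha>"
    using forced_superset[of "insert x (FV \<alpha>)" \<alpha>] finite_FV by auto
  show "forced ?F \<sigma> \<rho> ?\<beta>"
    unfolding forced_def val.simps
  proof (intro ballI impI)
    fix \<tau> assume t: "\<tau> \<in> paths" "prefix \<sigma> \<tau>" "defined_on ?F \<rho> \<tau>"
    \<comment> \<open>The last world is repeated until \<open>a\<close> is defined; its value there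
      is the witness at \<open>\<tau>\<close>.\<close>
    obtain \<tau>' where t': "\<tau>' \<in> paths" "prefix \<tau> \<tau>'" "last \<tau>' = last \<tau>"
        "defined_on (insert x (FV \<alpha>)) (\<rho>(x := a)) \<tau>'"
      using path_stay_defined[OF t(1), of "insert x (FV \<alpha>)"] finite_FV by blast
    have "val K (last \<tau>') (assign_at (\<rho>(x := a)) \<tau>') \<alpha>"
      using f t t' prefix_order.trans unfolding forced_def by blast
    also have "val K (last \<tau>') (assign_at (\<rho>(x := a)) \<tau>') \<alpha> =
        val K (last \<tau>') ((assign_at \<rho> \<tau>)(x := thread_at \<tau>' a)) \<alpha>"
      unfolding assign_at_upd
      by (rule val_cong) (use assign_at_prefix[OF t(3) t'(2)] in auto)
    finally have "val K (last \<tau>) ((assign_at \<rho> \<tau>)(x := thread_at \<tau>' a)) \<alpha>"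
      by (simp only: t'(3))
    moreover have "thread_at \<tau>' a \<in> indiv K (last \<tau>)"
      using thread_at_in_indiv[OF a t'(1)] t'(3,4) by (simp add: defined_on_def)
    ultimately show "\<exists>e\<in>indiv K (last \<tau>). val K (last \<tau>) ((assign_at \<rho> \<tau>)(x := e)) \<alpha>"
      by blast
  qed
qed

text \<open>The truth lemma: \<open>forced\<close> obeys the clauses of \<open>val\<close> in the
  thread model, the atomic one by construction.\<close>

lemma val_thread_model:
  assumes C: "\<forall>c\<in>C. supermultiplicative c"
    and "\<alpha> \<in> Fml C" "\<sigma> \<in> paths" "range \<rho> \<subseteq> threads"
  shows "val thread_model \<sigma> \<rho> \<alpha> \<longleftrightarrow> forced (FV \<alpha>) \<sigma> \<rho> \<alpha>"
  using assms(2-)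
proof (induction arbitrary: \<sigma> \<rho>)
  case (Atom xs p)
  show ?case
    by (auto simp: forced_def defined_on_def assign_at_def[abs_def] comp_def)
next
  case (Conn c \<alpha>s)
  have "map (val thread_model \<tau> \<rho>) \<alpha>s = map (\<lambda>\<alpha>. forced (FV \<alpha>) \<tau> \<rho> \<alpha>) \<alpha>s"
    if "\<tau> \<in> paths" for \<tau>
    using Conn that by simp
  moreover have "supermultiplicative c" using C Conn by blast
  ultimately show ?case
    using forced_Conn[OF _ Conn.hyps(2,3) Conn.prems(2)] by (simp del: map_eq_conv)
next
  case (All \<alpha> x)
  have "val thread_model \<tau> (\<rho>(x := a)) \<alpha> = forced (FV \<alpha>) \<tau> (\<rho>(x := a)) \<alpha>"
    if "\<tau> \<in> paths" "a \<in> threads" for \<tau> a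
    by (rule All.IH) (use All.prems that in auto)
  then show ?case
    unfolding forced_All[OF All.hyps All.prems(2)] by simp
next
  case (Ex \<alpha> x)
  have "val thread_model \<sigma> (\<rho>(x := a)) \<alpha> = forced (FV \<alpha>) \<sigma> (\<rho>(x := a)) \<alpha>"
    if "a \<in> threads" for a
    by (rule Ex.IH) (use Ex.prems that in auto)
  then show ?case
    unfolding forced_Ex[OF Ex.hyps Ex.prems(2,1)] by simp
qed

lemma sequent_val_if_valid_thread_model:
  assumes C: "\<forall>c\<in>C. supermultiplicative c" and S: "S \<in> sequents C"
    and "valid thread_model S" and \<rho>: "range \<rho> \<subseteq> indiv K w0"
  shows "sequent_val K w0 \<rho> S"
proof -
  \<comment> \<open>The only path of length 1 is \<open>[w0]\<close>, so these constant threads need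
    values in the domain of \<open>w0\<close> only, and they are defined at the root.\<close>
  define \<rho>' :: "var \<Rightarrow> ('w, 'd) thread" where "\<rho>' x = (1, \<lambda>_. \<rho> x)" for x
  have "last \<tau> = w0" if "\<tau> \<in> paths" "length \<tau> = 1" for \<tau>
    using that by (cases \<tau>) (auto simp: paths_def)
  then have r: "range \<rho>' \<subseteq> threads"
    using \<rho> by (auto simp: \<rho>'_def threads_def)
  have as: "assign_at \<rho>' [w0] = \<rho>"
    by (auto simp: assign_at_def thread_at_def \<rho>'_def)
  have "val thread_model [w0] \<rho>' \<alpha> = val K w0 \<rho> \<alpha>" if "\<alpha> \<in> Fml C" for \<alpha>
  proof -
    have "defined_on (FV \<alpha>) \<rho>' [w0]" by (simp add: defined_on_def \<rho>'_def)
    then show ?thesis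
      using val_thread_model[OF C that root_in_paths r] forced_defined[OF that r root_in_paths] as
      by simp
  qed
  moreover have "sequent_val thread_model [w0] \<rho>' S"
    using assms(3) root_in_paths r unfolding valid_def by simp
  ultimately show ?thesis
    using S unfolding sequent_val_def sequents_def case_prod_unfold mem_Collect_eq by blast
qed

end

theorem FOCDS_subset_FOILS:
  assumes "\<forall>c\<in>C. supermultiplicative c"
  shows "(FOCDS C :: ('s, 'p) sequent set) \<subseteq> FOILS C"
proof
  fix S :: "('s, 'p) sequent" assume S: "S \<in> FOCDS C"
  then have seq: "S \<in> sequents C" by (simp add: FOCDS_def)
  have "valid K S" if K: "kripke_model K" for K :: "(('s, 'p) fml, ('s, 'p) fml, 'p) kripke"
    unfolding valid_def
  proof (intro ballI allI impI)
    fix w and \<rho> :: "var \<Rightarrow> ('s, 'p) fml"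
    assume w: "w \<in> worlds K" and \<rho>: "range \<rho> \<subseteq> indiv K w"
    interpret rooted_kripke K w by standard (fact K w)+
    \<comment> \<open>Paths and threads form other types than those fixed in \<open>FOCDS\<close>,
      hence the transfer theorem.\<close>
    have "valid thread_model S"
      by (rule FOCDS_all_models[OF S kripke_model_thread_model constant_domain_thread_model])
    then show "sequent_val K w \<rho> S"
      by (rule sequent_val_if_valid_thread_model[OF assms seq _ \<rho>])
  qed
  then show "S \<in> FOILS C" using seq by (simp add: FOILS_def)
qed

subsection \<open>A separating sequent\<close>

text \<open>
  The four predicate symbols have different arities because there may be only one symbol of
  each arity.
\<close>

definition sep_r :: "('s, 'p) fml" where "sep_r = Atom (Pred undefined 0) []"
definition sep_p :: "('s, 'p) fml" where "sep_p = Atom (Pred undefined 1) [0]"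
definition sep_q :: "('s, 'p) fml" where "sep_q = Atom (Pred undefined 2) [0, 0]"
text \<open>The quantifiers of the sequent bind the variable 0, so with the variable 1 this atom
  acts as a propositional symbol.\<close>

definition sep_s :: "('s, 'p) fml" where "sep_s = Atom (Pred undefined 3) [1, 1, 1]"

definition sep_args :: "bool list \<Rightarrow> bool list \<Rightarrow> ('s, 'p) fml list" where
  "sep_args as bs =
     map2 (\<lambda>a b. if a then if b then sep_r else sep_p else if b then sep_q else sep_s) as bs"

definition sep_sequent :: "'s connective \<Rightarrow> bool list \<Rightarrow> bool list \<Rightarrow> ('s, 'p) sequent" where
  "sep_sequent c as bs =
     ({sep_r, All 0 (Conn c (sep_args as bs))}, {All 0 sep_p, Ex 0 sep_q, sep_s})"

lemmas sep_defs = sep_r_def sep_p_def sep_q_def sep_s_def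

lemma map_sep_args:
  assumes "length as = length bs" "v sep_r" "\<not> v sep_s"
  shows "v sep_p \<Longrightarrow> \<not> v sep_q \<Longrightarrow> map v (sep_args as bs) = as"
    and "\<not> v sep_p \<Longrightarrow> v sep_q \<Longrightarrow> map v (sep_args as bs) = bs"
    and "\<not> v sep_p \<Longrightarrow> \<not> v sep_q \<Longrightarrow> map v (sep_args as bs) = meet as bs"
  using assms by (induction as bs rule: list_induct2) (auto simp: sep_args_def meet_def min_def)

lemma sep_sequent_in_sequents:
  assumes "c \<in> C" "length as = arity c" "length bs = arity c"
  shows "sep_sequent c as bs \<in> sequents C"
proof -
  have at: "sep_r \<in> Fml C" "sep_p \<in> Fml C" "sep_q \<in> Fml C" "sep_s \<in> Fml C"
    by (auto simp: sep_defs intro!: Fml.Atom)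
  then have "set (sep_args as bs) \<subseteq> Fml C"
    by (auto simp: sep_args_def)
  then have "Conn c (sep_args as bs) \<in> Fml C"
    using assms by (intro Fml.Conn) (auto simp: sep_args_def)
  with at show ?thesis
    by (auto simp: sep_sequent_def sequents_def intro: Fml.intros)
qed

text \<open>At a refuting world no individual satisfies \<open>sep_q\<close>, so one without
  \<open>sep_p\<close> would give the arguments the values \<open>meet as bs\<close>, against the
  antecedent. Hence \<open>sep_p\<close> holds of the whole domain and persists, and a later
  counterexample to it would be a new individual.\<close>

lemma sep_sequent_valid:
  fixes c :: "'s connective" and K :: "('w, 'd, 'p) kripke"
  assumes len: "length as = length bs" and f: "\<not> truth_fun c (meet as bs)"
    and K: "kripke_model K" and D: "constant_domain K"
  shows "valid K (sep_sequent c as bs)"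
  unfolding valid_def sequent_val_def
proof (intro ballI allI impI notI)
  let ?r = "sep_r :: ('s, 'p) fml" and ?p = "sep_p :: ('s, 'p) fml"
    and ?q = "sep_q :: ('s, 'p) fml" and ?s = "sep_s :: ('s, 'p) fml"
    and ?args = "sep_args as bs :: ('s, 'p) fml list"
  fix w \<rho> assume w: "w \<in> worlds K" and \<rho>: "range \<rho> \<subseteq> indiv K w"
    and ref: "(\<forall>\<alpha>\<in>fst (sep_sequent c as bs). val K w \<rho> \<alpha>) \<and>
      (\<forall>\<beta>\<in>snd (sep_sequent c as bs). \<not> val K w \<rho> \<beta>)"
  have r: "val K w \<rho> ?r" and s: "\<not> val K w \<rho> ?s"
    and all: "val K w \<rho> (All 0 (Conn c ?args))"
    and np: "\<not> val K w \<rho> (All 0 ?p)" and nq: "\<not> val K w \<rho> (Ex 0 ?q)"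
    using ref unfolding sep_sequent_def fst_conv snd_conv by blast+
  have refl: "acc K w w" using K w unfolding kripke_model_def by blast
  have p: "val K w (\<rho>(0 := a)) ?p" if a: "a \<in> indiv K w" for a
  proof (rule ccontr)
    assume "\<not> val K w (\<rho>(0 := a)) ?p"
    moreover have "\<not> val K w (\<rho>(0 := a)) ?q" using nq a by auto
    moreover have "val K w (\<rho>(0 := a)) ?r" "\<not> val K w (\<rho>(0 := a)) ?s"
      using r s by (auto simp: sep_defs)
    ultimately have "map (val K w (\<rho>(0 := a))) ?args = meet as bs"
      by (intro map_sep_args(3) len)
    moreover have "truth_fun c (map (val K w (\<rho>(0 := a))) ?args)"
      using all a w refl unfolding val.simps by blast
    ultimately show False using f by simp
  qed
  obtain v a where v: "v \<in> worlds K" "acc K w v" and a: "a \<in> indiv K v"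
    and npa: "\<not> val K v (\<rho>(0 := a)) ?p"
    using np by auto
  have "a \<in> indiv K w" using D w v(1) a unfolding constant_domain_def by blast
  moreover have "?p \<in> Fml {}" by (auto simp: sep_p_def intro: Fml.Atom)
  ultimately have "val K v (\<rho>(0 := a)) ?p"
    using \<rho> by (intro val_persistent[OF K _ w v _ p]) auto
  with npa show False ..
qed

text \<open>The Booleans serve both as worlds and as individuals; the individual \<open>True\<close>
  is born at the world \<open>True\<close>. The arities tell the four atoms apart, and
  \<open>sep_s\<close> is never true.\<close>

definition sep_model :: "(bool, bool, 'p) kripke" where
  "sep_model = \<lparr>worlds = UNIV, acc = (\<le>), indiv = (\<lambda>w. {..w}),
     interp = (\<lambda>w p as. pred_arity p = 0 \<or> pred_arity p = 1 \<and> \<not> hd as \<or> pred_arity p = 2 \<and> hd as)\<rparr>"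

lemma kripke_model_sep_model: "kripke_model sep_model"
  by (auto simp: kripke_model_def sep_model_def)

text \<open>The individual \<open>False\<close> gives the arguments the values \<open>as\<close>,
  and \<open>True\<close> gives \<open>bs\<close>, so the connective holds throughout. At the upper
  world \<open>True\<close> refutes \<open>sep_p\<close>, but it is absent from the lower world and
  cannot witness \<open>sep_q\<close> there.\<close>

lemma sep_sequent_not_valid:
  fixes c :: "'s connective"
  assumes len: "length as = length bs" and f: "truth_fun c as" "truth_fun c bs"
  shows "\<not> valid sep_model (sep_sequent c as bs :: ('s, 'p) sequent)"
proof -
  let ?K = "sep_model :: (bool, bool, 'p) kripke" and ?\<rho> = "\<lambda>_ :: var. False"
  let ?r = "sep_r :: ('s, 'p) fml" and ?p = "sep_p :: ('s, 'p) fml"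
    and ?q = "sep_q :: ('s, 'p) fml" and ?s = "sep_s :: ('s, 'p) fml"
    and ?args = "sep_args as bs :: ('s, 'p) fml list"
  have val: "val ?K w (?\<rho>(0 := a)) ?r" "\<not> val ?K w (?\<rho>(0 := a)) ?s"
    "val ?K w (?\<rho>(0 := a)) ?p \<longleftrightarrow> \<not> a" "val ?K w (?\<rho>(0 := a)) ?q \<longleftrightarrow> a" for w a
    by (auto simp: sep_defs sep_model_def)
  have "truth_fun c (map (val ?K w (?\<rho>(0 := a))) ?args)" for w a
    using map_sep_args(1,2)[OF len, of "val ?K w (?\<rho>(0 := a))", OF val(1,2)]
      val(3,4)[of w a] f by (cases a) auto
  then have "val ?K False ?\<rho> (All 0 (Conn c ?args))" by simp
  moreover have "\<not> val ?K False ?\<rho> (All 0 ?p)"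
    using val(3)[of True True] by (auto simp: sep_model_def)
  moreover have "\<not> val ?K False ?\<rho> (Ex 0 ?q)"
    using val(4) by (auto simp: sep_model_def)
  moreover have "val ?K False ?\<rho> ?r" "\<not> val ?K False ?\<rho> ?s"
    by (auto simp: sep_defs sep_model_def)
  ultimately have "\<not> sequent_val ?K False ?\<rho> (sep_sequent c as bs)"
    unfolding sequent_val_def sep_sequent_def fst_conv snd_conv by blast
  moreover have "False \<in> worlds ?K" "range ?\<rho> \<subseteq> indiv ?K False"
    by (auto simp: sep_model_def)
  ultimately show ?thesis unfolding valid_def by blast
qed

theorem theorem1:
  fixes C :: "'s connective set"
  shows "(FOILS C :: ('s, 'p) sequent set) = FOCDS C \<longleftrightarrow> (\<forall>c\<in>C. supermultiplicative c)"
proof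
  assume eq: "(FOILS C :: ('s, 'p) sequent set) = FOCDS C"
  show "\<forall>c\<in>C. supermultiplicative c"
  proof (intro ballI, rule ccontr)
    fix c assume c: "c \<in> C" "\<not> supermultiplicative c"
    then obtain as bs where len: "length as = arity c" "length bs = arity c"
      and f: "truth_fun c as" "truth_fun c bs" "\<not> truth_fun c (meet as bs)"
      unfolding supermultiplicative_def by blast
    let ?S = "sep_sequent c as bs :: ('s, 'p) sequent"
    have len': "length as = length bs" using len by simp
    have "?S \<in> FOCDS C"
      using sep_sequent_in_sequents[OF c(1) len] sep_sequent_valid[OF len' f(3)]
      unfolding FOCDS_def by blast
    then have "?S \<in> FOILS C" using eq by simp
    \<comment> \<open>The model lives on Booleans instead of formulas, so validity is transferred
      between types.\<close>
    then have "valid sep_model ?S" using kripke_model_sep_model by (rule FOILS_all_models)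
    then show False using sep_sequent_not_valid[OF len' f(1,2)] by blast
  qed
next
  assume "\<forall>c\<in>C. supermultiplicative c"
  moreover have "(FOILS C :: ('s, 'p) sequent set) \<subseteq> FOCDS C"
    by (auto simp: FOILS_def FOCDS_def)
  ultimately show "(FOILS C :: ('s, 'p) sequent set) = FOCDS C"
    using FOCDS_subset_FOILS by blast
qed

end
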